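(* Let $d\ge 2$, let $f$ be a probability density function on $\mathbb{R}^d$ with one-dimensional marginals $f^{\star 1},\ldots,f^{\star d}$, and let $\varphi$ be the scaling function of a multiresolution analysis of $L_2(\mathbb{R})$ satisfying the concentration condition $\sum_{k\in\mathbb{Z}}|\varphi(x+k)|\le C$ for almost every $x$. Let $j\in\mathbb{Z}$ and define the contrast $$C_j(f)=\sum_{(k^1,\ldots,k^d)\in\mathbb{Z}^d}\bigl(\alpha_{jk^1,\ldots,k^d}-\alpha_{jk^1}\cdots\alpha_{jk^d}\bigr)^2,$$ where $\alpha_{jk^\ell}=\int_{\mathbb{R}} f^{\star\ell}(x^\ell)\varphi_{jk^\ell}(x^\ell)\,dx^\ell$ and $\alpha_{jk^1,\ldots,k^d}=\int_{\mathbb{R}^d}f(x)\Phi_{jk^1,\ldots,k^d}(x)\,dx$. Then: 1. If $f$ is factorizable, then $C_j(f)=0$. 2. If $f$ and $\varphi$ are compactly supported, or else if $f\in L_2(\mathbb{R}^d)$, then $C_j(f)=0$ implies $P_jf=\prod_{\ell=1}^d P_j^\ell f^{\star\ell}$, i.e. $(P_jf)(x)=\prod_{\ell=1}^d(P_j^\ell f^{\star\ell})(x^\ell)$ for almost every $x=(x^1,\ldots,x^d)$.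
   Context: All functions are real-valued. A multiresolution analysis of $L_2(\mathbb{R})$ with scaling function $\varphi\in L_2(\mathbb{R})$: the translates $\{\varphi(\cdot-k),k\in\mathbb{Z}\}$ are orthonormal, $V_j$ is the closed span of $\varphi_{jk}(x)=2^{j/2}\varphi(2^jx-k)$, $k\in\mathbb{Z}$, one has $V_j\subset V_{j+1}$, and $\bigcup_{j\ge0}V_j$ is dense in $L_2(\mathbb{R})$. For $x=(x^1,\ldots,x^d)\in\mathbb{R}^d$ put $\Phi(x)=\prod_{\ell=1}^d\varphi(x^\ell)$, and for $k=(k^1,\ldots,k^d)\in\mathbb{Z}^d$ put $\Phi_{jk}(x)=\Phi_{jk^1,\ldots,k^d}(x)=2^{jd/2}\Phi(2^jx-k)=\prod_\ell\varphi_{jk^\ell}(x^\ell)$. The marginal in dimension $\ell$ of $f$ is $f^{\star\ell}(x^\ell)=\int_{\mathbb{R}^{d-1}}f(x^1,\ldots,x^d)\,dx^1\cdots dx^{\ell-1}dx^{\ell+1}\cdots dx^d$. The density $f$ is factorizable if it is the product of its marginals: $f(x)=\prod_\ell f^{\star\ell}(x^\ell)$ a.e. (the components are independent). The projections at level $j$ are $P_jf=\sum_{k\in\mathbb{Z}^d}\alpha_{jk}\Phi_{jk}$ and $P_j^\ell f^{\star\ell}=\sum_{k^\ell\in\mathbb{Z}}\alpha_{jk^\ell}\varphi_{jk^\ell}$, with the coefficients $\alpha_{jk}=\alpha_{jk^1,\ldots,k^d}$ and $\alpha_{jk^\ell}$ given in the statement. *)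

theory Defs
  imports "HOL-Analysis.Analysis"
begin

text \<open>
  Elements of \<open>L\<^sub>2\<close> and densities are represented by Borel measurable functions, with
  functions that agree almost everywhere not identified.  The space \<open>\<real>\<^sup>d\<close> is
  \<open>real ^ 'd\<close> and the index set \<open>\<int>\<^sup>d\<close> is \<open>int ^ 'd\<close>.
\<close>

definition square_integrable :: "('a::euclidean_space \<Rightarrow> real) \<Rightarrow> bool" where
  "square_integrable g \<longleftrightarrow>
     g \<in> borel_measurable lborel \<and> integrable lborel (\<lambda>x. (g x)\<^sup>2)"

definition L2_dist :: "(real \<Rightarrow> real) \<Rightarrow> (real \<Rightarrow> real) \<Rightarrow> real" where
  "L2_dist g h = sqrt (LINT x|lborel. (g x - h x)\<^sup>2)"

text \<open>Supports are taken up to null sets, as is appropriate for classes of functions.\<close>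

definition compactly_supported :: "('a::euclidean_space \<Rightarrow> real) \<Rightarrow> bool" where
  "compactly_supported g \<longleftrightarrow>
     (\<exists>K. compact K \<and> (AE x in lborel. x \<notin> K \<longrightarrow> g x = 0))"


subsection \<open>Multiresolution analysis\<close>

definition dilate :: "(real \<Rightarrow> real) \<Rightarrow> int \<Rightarrow> int \<Rightarrow> real \<Rightarrow> real" where
  "dilate \<phi> j k x = 2 powr (of_int j / 2) * \<phi> (2 powi j * x - of_int k)"

definition closed_span :: "('i \<Rightarrow> real \<Rightarrow> real) \<Rightarrow> (real \<Rightarrow> real) set" where
  "closed_span u = {g. square_integrable g \<and>
     (\<forall>\<epsilon>>0. \<exists>K c. finite K \<and> L2_dist g (\<lambda>x. \<Sum>k\<in>K. c k * u k x) < \<epsilon>)}"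

definition V :: "(real \<Rightarrow> real) \<Rightarrow> int \<Rightarrow> (real \<Rightarrow> real) set" where
  "V \<phi> j = closed_span (dilate \<phi> j)"

definition mra_scaling_function :: "(real \<Rightarrow> real) \<Rightarrow> bool" where
  "mra_scaling_function \<phi> \<longleftrightarrow>
     square_integrable \<phi> \<and>
     (\<forall>k m :: int. (LINT x|lborel. \<phi> (x - of_int k) * \<phi> (x - of_int m)) =
        (if k = m then 1 else 0)) \<and>
     (\<forall>j. V \<phi> j \<subseteq> V \<phi> (j + 1)) \<and>
     (\<forall>g. square_integrable g \<longrightarrow>
        (\<forall>\<epsilon>>0. \<exists>h \<in> (\<Union>j\<in>{0..}. V \<phi> j). L2_dist g h < \<epsilon>))"

definition tensor :: "(real \<Rightarrow> real) \<Rightarrow> real ^ 'd \<Rightarrow> real" where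
  "tensor \<phi> x = (\<Prod>l\<in>UNIV. \<phi> (x $ l))"

definition tensor_dilate ::
    "(real \<Rightarrow> real) \<Rightarrow> int \<Rightarrow> int ^ 'd \<Rightarrow> real ^ 'd \<Rightarrow> real" where
  "tensor_dilate \<phi> j k x =
     2 powr (of_int j * real CARD('d) / 2) *
     tensor \<phi> (2 powi j *\<^sub>R x - (\<chi> l. of_int (k $ l)))"


subsection \<open>Densities and marginals\<close>

definition prob_density :: "('a::euclidean_space \<Rightarrow> real) \<Rightarrow> bool" where
  "prob_density f \<longleftrightarrow>
     integrable lborel f \<and> (AE x in lborel. 0 \<le> f x) \<and> (LINT x|lborel. f x) = 1"

definition marginal :: "'d \<Rightarrow> (real ^ 'd \<Rightarrow> real) \<Rightarrow> real \<Rightarrow> real" where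
  "marginal l f t =
     (LINT y|Pi\<^sub>M (UNIV - {l}) (\<lambda>_. lborel). f (\<chi> i. if i = l then t else y i))"

definition factorizable :: "(real ^ 'd \<Rightarrow> real) \<Rightarrow> bool" where
  "factorizable f \<longleftrightarrow> (AE x in lborel. f x = (\<Prod>l\<in>UNIV. marginal l f (x $ l)))"


subsection \<open>Coefficients, projections and contrast\<close>

definition coeff1 :: "(real \<Rightarrow> real) \<Rightarrow> int \<Rightarrow> (real \<Rightarrow> real) \<Rightarrow> int \<Rightarrow> real" where
  "coeff1 \<phi> j g k = (LINT t|lborel. g t * dilate \<phi> j k t)"

definition coeff :: "(real \<Rightarrow> real) \<Rightarrow> int \<Rightarrow> (real ^ 'd \<Rightarrow> real) \<Rightarrow> int ^ 'd \<Rightarrow> real" where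
  "coeff \<phi> j f k = (LINT x|lborel. f x * tensor_dilate \<phi> j k x)"

text \<open>
  The projection series are summed pointwise.  For an integrable \<open>f\<close> and a \<open>\<phi>\<close>
  satisfying the concentration condition, the coefficients are bounded and the series
  converge absolutely at almost every point, so the default value 0 of a divergent
  infinite sum occurs at most on a null set.
\<close>

definition proj1 :: "(real \<Rightarrow> real) \<Rightarrow> int \<Rightarrow> (real \<Rightarrow> real) \<Rightarrow> real \<Rightarrow> real" where
  "proj1 \<phi> j g t = (\<Sum>\<^sub>\<infinity>k. coeff1 \<phi> j g k * dilate \<phi> j k t)"

definition proj :: "(real \<Rightarrow> real) \<Rightarrow> int \<Rightarrow> (real ^ 'd \<Rightarrow> real) \<Rightarrow> real ^ 'd \<Rightarrow> real" where
  "proj \<phi> j f x = (\<Sum>\<^sub>\<infinity>k. coeff \<phi> j f k * tensor_dilate \<phi> j k x)"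

text \<open>
  The contrast takes values in \<open>[0, \<infinity>]\<close>, so that it cannot vanish because of divergence.
\<close>

definition contrast :: "(real \<Rightarrow> real) \<Rightarrow> int \<Rightarrow> (real ^ 'd \<Rightarrow> real) \<Rightarrow> ennreal" where
  "contrast \<phi> j f =
     (\<Sum>\<^sub>\<infinity>k. ennreal ((coeff \<phi> j f k -
        (\<Prod>l\<in>UNIV. coeff1 \<phi> j (marginal l f) (k $ l)))\<^sup>2))"

end

theory Submission
  imports Defs
begin

text \<open>
  \<open>\<Phi>\<^sub>j\<^sub>k\<close> is a product over the coordinates.  For factorizable \<open>f\<close>, Fubini's theorem
  therefore factors each \<open>d\<close>-dimensional coefficient.  Conversely, a vanishing contrast makes
  every coefficient factor, and \<open>P\<^sub>j f(x)\<close> becomes an absolutely convergent sum of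
  products over \<open>\<int>\<^sup>d\<close>, which is the product of the coordinate sums.  Absolute convergence
  comes from the concentration condition: it bounds \<open>\<phi>\<close> almost everywhere, so the coefficients
  of an integrable function are bounded, and it makes the translates of \<open>\<phi>\<close> absolutely
  summable.
\<close>

subsection \<open>Lebesgue measure on vectors as a product measure\<close>

lemma product_sigma_finite_lborel: "product_sigma_finite (\<lambda>_. lborel :: real measure)"
  by unfold_locales

lemma measurable_vec_lambda [measurable]:
  "(\<lambda>y. \<chi> i. y i) \<in> measurable (Pi\<^sub>M UNIV (\<lambda>_::'d::finite. lborel)) (borel :: (real ^ 'd) measure)"
  by (subst borel_measurable_euclidean_space)
     (auto simp: Basis_vec_def inner_axis)

lemma measurable_vec_nth [measurable]:
  "(\<lambda>x. x $ l) \<in> borel_measurable (borel :: (real ^ 'd::finite) measure)"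
  by (intro borel_measurable_continuous_onI continuous_intros)

text \<open>Lebesgue measure is determined by its values on boxes, and a box pulls back to a product
  of intervals. This carries Fubini's theorem over from \<open>Pi\<^sub>M\<close> to
  vectors.\<close>

lemma lborel_vec_eq_distr:
  "(lborel :: (real ^ 'd::finite) measure) =
     distr (Pi\<^sub>M UNIV (\<lambda>_. lborel)) borel (\<lambda>y. \<chi> i. y i)"
proof (rule lborel_eqI)
  interpret product_sigma_finite "\<lambda>_::'d. lborel :: real measure"
    by (rule product_sigma_finite_lborel)
  fix l u :: "real ^ 'd"
  assume le: "\<And>b. b \<in> Basis \<Longrightarrow> l \<bullet> b \<le> u \<bullet> b"
  have le': "l $ i \<le> u $ i" for i
    using le[of "axis i 1"] by (simp add: inner_axis)
  have "(\<lambda>y. \<chi> i. y i) -` box l u \<inter> space (Pi\<^sub>M UNIV (\<lambda>_::'d. lborel :: real measure))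
      = Pi\<^sub>E UNIV (\<lambda>i. {l $ i<..<u $ i})"
    by (auto simp: mem_box_cart space_PiM PiE_def Pi_def)
  then have "emeasure (distr (Pi\<^sub>M UNIV (\<lambda>_. lborel)) borel (\<lambda>y. \<chi> i. y i)) (box l u)
      = (\<Prod>i\<in>UNIV. ennreal (u $ i - l $ i))"
    by (simp add: emeasure_distr emeasure_PiM le')
  also have "\<dots> = (\<Prod>i\<in>UNIV. u $ i - l $ i)"
    by (simp add: prod_ennreal le')
  \<comment> \<open>The basis vectors are exactly the \<open>axis i 1\<close>, so the product over
    \<open>Basis\<close> reindexes to one over coordinates.\<close>
  also have "(\<Prod>i\<in>UNIV. u $ i - l $ i) = (\<Prod>b\<in>Basis. (u - l) \<bullet> b)"
    by (simp add: Basis_vec_def UNION_singleton_eq_range image_image prod.reindex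
        inj_on_def axis_eq_axis inner_axis)
  finally show "emeasure (distr (Pi\<^sub>M UNIV (\<lambda>_. lborel)) borel (\<lambda>y. \<chi> i. y i)) (box l u)
      = (\<Prod>b\<in>Basis. (u - l) \<bullet> b)" .
qed simp

lemma lborel_vec_integral_prod:
  fixes g :: "'d::finite \<Rightarrow> real \<Rightarrow> real"
  assumes "\<And>l. integrable lborel (g l)"
  shows "(LINT x|(lborel :: (real ^ 'd) measure). (\<Prod>l\<in>UNIV. g l (x $ l)))
      = (\<Prod>l\<in>UNIV. (LINT t|lborel. g l t))"
proof -
  interpret product_sigma_finite "\<lambda>_::'d. lborel :: real measure"
    by (rule product_sigma_finite_lborel)
  have [measurable]: "g l \<in> borel_measurable borel" for l
    using borel_measurable_integrable[OF assms[of l]] by simp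
  have "(LINT x|(lborel :: (real ^ 'd) measure). (\<Prod>l\<in>UNIV. g l (x $ l)))
      = (LINT y|Pi\<^sub>M UNIV (\<lambda>_::'d. lborel). (\<Prod>l\<in>UNIV. g l (y l)))"
    by (subst lborel_vec_eq_distr, subst integral_distr) measurable
  also have "\<dots> = (\<Prod>l\<in>UNIV. (LINT t|lborel. g l t))"
    by (rule product_integral_prod) (use assms in auto)
  finally show ?thesis .
qed

text \<open>The exceptional points lie in a cylinder over a null set of the line, which is a product
  set with one null factor.\<close>

lemma AE_lborel_vec_nth:
  assumes "AE t in lborel. P t"
  shows "AE x in (lborel :: (real ^ 'd::finite) measure). P (x $ l)"
proof -
  interpret product_sigma_finite "\<lambda>_::'d. lborel :: real measure"
    by (rule product_sigma_finite_lborel)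
  obtain N where N: "{t. \<not> P t} \<subseteq> N" "emeasure lborel N = 0" "N \<in> sets borel"
    using AE_E[OF assms] by auto
  define A where "A i = (if i = l then N else UNIV)" for i :: 'd
  have A: "A i \<in> sets lborel" for i
    using N by (simp add: A_def)
  have "(\<lambda>y. \<chi> i. y i) -` {x. x $ l \<in> N} \<inter> space (Pi\<^sub>M UNIV (\<lambda>_::'d. lborel :: real measure))
      = Pi\<^sub>E UNIV A"
    by (auto simp: A_def space_PiM PiE_def Pi_def split: if_splits)
  moreover have [measurable]: "{x :: real ^ 'd. x $ l \<in> N} \<in> sets borel"
    using measurable_sets[OF measurable_vec_nth N(3)] by (simp add: vimage_def)
  ultimately have "emeasure lborel {x :: real ^ 'd. x $ l \<in> N} = (\<Prod>i\<in>UNIV. emeasure lborel (A i))"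
    using A by (subst lborel_vec_eq_distr) (simp add: emeasure_distr emeasure_PiM)
  \<comment> \<open>The other factors are all of the line and have infinite measure; in
    \<open>ennreal\<close> the zero factor still makes the product zero.\<close>
  also have "\<dots> = 0"
    using N(2) by (intro prod_zero) (auto simp: A_def)
  finally have "{x :: real ^ 'd. x $ l \<in> N} \<in> null_sets lborel"
    by auto
  then show ?thesis
    by (rule AE_I') (use N in auto)
qed

text \<open>The image of Lebesgue measure under an invertible affine map is a positive multiple of
  it, so both have the same null sets.\<close>

lemma AE_lborel_affine:
  fixes P :: "real \<Rightarrow> bool"
  assumes "AE x in lborel. P x" and "c \<noteq> 0"
  shows "AE x in lborel. P (t + c * x)"
proof -
  have "AE x in distr lborel borel (\<lambda>x. t + c * x). P x"
    using assms by (subst (asm) lborel_real_affine[OF assms(2), of t]) (simp add: AE_density)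
  then show ?thesis
    by (rule AE_distrD[rotated]) auto
qed

text \<open>Splits off coordinate \<open>l\<close> in the way \<open>marginal\<close> does. The
  product measure is characterised by its values on rectangles, so comparing those suffices.\<close>

lemma distr_pair_PiM_upd:
  "distr (lborel \<Otimes>\<^sub>M Pi\<^sub>M (UNIV - {l}) (\<lambda>_. lborel)) (Pi\<^sub>M UNIV (\<lambda>_::'d::finite. lborel :: real measure))
     (\<lambda>(t, y). y(l := t)) = Pi\<^sub>M UNIV (\<lambda>_. lborel)" (is "distr ?Q ?M ?h = ?M")
proof -
  interpret product_sigma_finite "\<lambda>_::'d. lborel :: real measure"
    by (rule product_sigma_finite_lborel)
  interpret Y: sigma_finite_measure "Pi\<^sub>M (UNIV - {l}) (\<lambda>_::'d. lborel :: real measure)"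
    by (rule sigma_finite) simp
  have h [measurable]: "?h \<in> measurable ?Q ?M"
    unfolding split_beta' by (rule measurable_fun_upd[where J = "UNIV - {l}"]) auto
  show ?thesis
  proof (rule PiM_eqI)
    fix A :: "'d \<Rightarrow> real set"
    assume A: "\<And>i. i \<in> UNIV \<Longrightarrow> A i \<in> sets lborel"
    \<comment> \<open>Points of the second factor are \<open>undefined\<close> at \<open>l\<close>,
      and the update overwrites just that entry; hence the preimage is again a rectangle.\<close>
    have "?h -` Pi\<^sub>E UNIV A \<inter> space ?Q = A l \<times> Pi\<^sub>E (UNIV - {l}) A"
      by (auto simp: space_pair_measure space_PiM PiE_def Pi_def split: if_splits)
    then have "emeasure (distr ?Q ?M ?h) (Pi\<^sub>E UNIV A)
        = emeasure lborel (A l) * (\<Prod>i\<in>UNIV - {l}. emeasure lborel (A i))"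
      using A by (simp add: emeasure_distr sets_PiM_I_finite Y.emeasure_pair_measure_Times emeasure_PiM)
    also have "\<dots> = (\<Prod>i\<in>UNIV. emeasure lborel (A i))"
      by (subst (2) prod.remove[of _ l]) auto
    finally show "emeasure (distr ?Q ?M ?h) (Pi\<^sub>E UNIV A) = (\<Prod>i\<in>UNIV. emeasure lborel (A i))" .
  qed auto
qed

text \<open>After moving \<open>f\<close> to the product of coordinate \<open>l\<close> with the
  remaining ones, this is the part of Fubini's theorem saying that the inner integral is
  integrable.\<close>

lemma integrable_marginal:
  fixes f :: "real ^ 'd::finite \<Rightarrow> real"
  assumes "integrable lborel f"
  shows "integrable lborel (marginal l f)"
proof -
  interpret product_sigma_finite "\<lambda>_::'d. lborel :: real measure"
    by (rule product_sigma_finite_lborel)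
  interpret pair_sigma_finite "lborel :: real measure" "Pi\<^sub>M (UNIV - {l}) (\<lambda>_. lborel :: real measure)"
    by (intro pair_sigma_finite.intro sigma_finite) (simp_all add: lborel.sigma_finite_measure_axioms)
  let ?Q = "lborel \<Otimes>\<^sub>M Pi\<^sub>M (UNIV - {l}) (\<lambda>_::'d. lborel :: real measure)"
  have h: "(\<lambda>(t, y). y(l := t)) \<in> measurable ?Q (Pi\<^sub>M UNIV (\<lambda>_. lborel))"
    unfolding split_beta' by (rule measurable_fun_upd[where J = "UNIV - {l}"]) auto
  have [measurable]: "f \<in> borel_measurable borel"
    using borel_measurable_integrable[OF assms] by simp
  have "integrable (Pi\<^sub>M UNIV (\<lambda>_. lborel)) (\<lambda>y. f (\<chi> i. y i))"
    using assms by (subst (asm) lborel_vec_eq_distr) (simp add: integrable_distr_eq)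
  then have "integrable ?Q (\<lambda>p. f (\<chi> i. (case p of (t, y) \<Rightarrow> y(l := t)) i))"
    by (subst (asm) distr_pair_PiM_upd[of l, symmetric], subst (asm) integrable_distr_eq[OF h]) simp_all
  then have "integrable ?Q (\<lambda>(t, y). f (\<chi> i. if i = l then t else y i))"
    by (simp add: case_prod_beta' fun_upd_def)
  then show ?thesis
    unfolding marginal_def using integrable_fst by blast
qed

subsection \<open>Dilated translates and their coefficients\<close>

lemma measurable_dilate [measurable]:
  assumes [measurable]: "\<phi> \<in> borel_measurable borel"
  shows "dilate \<phi> j k \<in> borel_measurable borel"
  unfolding dilate_def by measurable

text \<open>The normalising factor splits into one factor 2^(j/2) per coordinate.\<close>

lemma tensor_dilate_eq_prod:
  fixes x :: "real ^ 'd"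
  shows "tensor_dilate \<phi> j k x = (\<Prod>l\<in>UNIV. dilate \<phi> j (k $ l) (x $ l))"
proof -
  have "2 powr (real_of_int j * real CARD('d) / 2) = (2 powr (real_of_int j / 2)) ^ CARD('d)"
    by (simp add: powr_powr powr_realpow[symmetric])
  then show ?thesis
    by (simp add: tensor_dilate_def dilate_def tensor_def prod.distrib)
qed

text \<open>The concentration condition is read at the point 2^j t. It sums over x + k while
  \<open>dilate\<close> uses x - k, so the index is reflected.\<close>

lemma AE_dilate_abs_summable:
  assumes "AE x in lborel. (\<lambda>k::int. \<bar>\<phi> (x + of_int k)\<bar>) summable_on UNIV"
  shows "AE t in lborel. (\<lambda>k. \<bar>dilate \<phi> j k t\<bar>) summable_on UNIV"
proof -
  have "AE t in lborel. (\<lambda>k::int. \<bar>\<phi> ((0 + 2 powi j * t) + of_int k)\<bar>) summable_on UNIV"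
    by (rule AE_lborel_affine[OF assms]) simp
  then show ?thesis
  proof (rule AE_mp, intro AE_I2 impI)
    fix t
    assume "(\<lambda>k::int. \<bar>\<phi> ((0 + 2 powi j * t) + of_int k)\<bar>) summable_on UNIV"
    then have "((\<lambda>k::int. \<bar>\<phi> (2 powi j * t + of_int k)\<bar>) \<circ> uminus) summable_on UNIV"
      by (subst summable_on_reindex[symmetric]) (auto simp: surj_def intro: exI[of _ "- _"])
    then have "(\<lambda>k::int. 2 powr (of_int j / 2) * \<bar>\<phi> (2 powi j * t - of_int k)\<bar>) summable_on UNIV"
      by (intro summable_on_cmult_right) (simp add: o_def)
    then show "(\<lambda>k. \<bar>dilate \<phi> j k t\<bar>) summable_on UNIV"
      by (simp add: dilate_def abs_mult)
  qed
qed

lemma AE_dilate_bounded: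
  assumes "AE x in lborel. \<bar>\<phi> x\<bar> \<le> C"
  shows "AE t in lborel. \<bar>dilate \<phi> j k t\<bar> \<le> 2 powr (of_int j / 2) * C"
proof -
  have "AE t in lborel. \<bar>\<phi> (- of_int k + 2 powi j * t)\<bar> \<le> C"
    by (rule AE_lborel_affine[OF assms]) simp
  then show ?thesis
    by eventually_elim (simp add: dilate_def abs_mult mult_left_mono)
qed

lemma integrable_mult_dilate:
  assumes "integrable lborel g" and [measurable]: "\<phi> \<in> borel_measurable borel"
    and "AE x in lborel. \<bar>\<phi> x\<bar> \<le> C"
  shows "integrable lborel (\<lambda>t. g t * dilate \<phi> j k t)"
proof (rule Bochner_Integration.integrable_bound)
  show "integrable lborel (\<lambda>t. (2 powr (of_int j / 2) * C) * \<bar>g t\<bar>)"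
    using assms(1) by simp
  show "(\<lambda>t. g t * dilate \<phi> j k t) \<in> borel_measurable lborel"
    using borel_measurable_integrable[OF assms(1)] by simp
  show "AE t in lborel. norm (g t * dilate \<phi> j k t) \<le> norm ((2 powr (of_int j / 2) * C) * \<bar>g t\<bar>)"
    using AE_dilate_bounded[OF assms(3), of j k]
  proof eventually_elim
    case (elim t)
    \<comment> \<open>The sign of \<open>C\<close> is not assumed here, so the bound is passed to
      its absolute value.\<close>
    then have "\<bar>dilate \<phi> j k t\<bar> \<le> \<bar>2 powr (of_int j / 2) * C\<bar>"
      by linarith
    then show ?case
      by (simp add: abs_mult mult.commute mult_left_mono)
  qed
qed

text \<open>The bound does not depend on \<open>k\<close>, so multiplying by the coefficients
  preserves absolute summability of the translates.\<close>

lemma coeff1_bounded: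
  assumes g: "integrable lborel g" and [measurable]: "\<phi> \<in> borel_measurable borel"
    and C: "AE x in lborel. \<bar>\<phi> x\<bar> \<le> C"
  shows "\<bar>coeff1 \<phi> j g k\<bar> \<le> 2 powr (of_int j / 2) * C * (LINT t|lborel. \<bar>g t\<bar>)"
proof -
  have "\<bar>coeff1 \<phi> j g k\<bar> \<le> (LINT t|lborel. \<bar>g t * dilate \<phi> j k t\<bar>)"
    unfolding coeff1_def by (rule integral_abs_bound)
  also have "\<dots> \<le> (LINT t|lborel. (2 powr (of_int j / 2) * C) * \<bar>g t\<bar>)"
  proof (rule integral_mono_AE)
    show "integrable lborel (\<lambda>t. \<bar>g t * dilate \<phi> j k t\<bar>)"
      using integrable_mult_dilate[OF assms, of j k] by simp
    show "integrable lborel (\<lambda>t. (2 powr (of_int j / 2) * C) * \<bar>g t\<bar>)"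
      using g by simp
    show "AE t in lborel. \<bar>g t * dilate \<phi> j k t\<bar> \<le> (2 powr (of_int j / 2) * C) * \<bar>g t\<bar>"
      using AE_dilate_bounded[OF C, of j k]
      by eventually_elim (simp add: abs_mult mult.commute mult_left_mono)
  qed
  finally show ?thesis by simp
qed

subsection \<open>Factorization of sums and coefficients\<close>

text \<open>Distributivity for absolutely convergent series, with vectors of indices identified with
  functions on the coordinates.\<close>

lemma infsum_prod_vec:
  fixes F :: "'d::finite \<Rightarrow> 'b \<Rightarrow> real"
  assumes "\<And>l. (\<lambda>m. \<bar>F l m\<bar>) summable_on UNIV"
  shows "(\<Sum>\<^sub>\<infinity>k::'b ^ 'd. \<Prod>l\<in>UNIV. F l (k $ l)) = (\<Prod>l\<in>UNIV. \<Sum>\<^sub>\<infinity>m. F l m)"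
proof -
  have "bij_betw vec_nth (UNIV :: ('b ^ 'd) set) (Pi\<^sub>E UNIV (\<lambda>_. UNIV))"
    by (rule bij_betwI[where g = vec_lambda]) auto
  then have "(\<Sum>\<^sub>\<infinity>k::'b ^ 'd. \<Prod>l\<in>UNIV. F l (k $ l))
      = (\<Sum>\<^sub>\<infinity>g\<in>Pi\<^sub>E UNIV (\<lambda>_. UNIV). \<Prod>l\<in>UNIV. F l (g l))"
    by (rule infsum_reindex_bij_betw)
  also have "\<dots> = (\<Prod>l\<in>UNIV. \<Sum>\<^sub>\<infinity>m. F l m)"
    by (rule infsum_prod_PiE_abs) (use assms in auto)
  finally show ?thesis .
qed

text \<open>In \<open>ennreal\<close> every family is summable and each term is at most the total,
  so a zero total forces every square to vanish.\<close>

lemma contrast_eq_0_iff: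
  fixes f :: "real ^ 'd \<Rightarrow> real"
  shows "contrast \<phi> j f = 0 \<longleftrightarrow>
    (\<forall>k. coeff \<phi> j f k = (\<Prod>l\<in>UNIV. coeff1 \<phi> j (marginal l f) (k $ l)))"
proof
  assume 0: "contrast \<phi> j f = 0"
  let ?e = "\<lambda>k. ennreal ((coeff \<phi> j f k - (\<Prod>l\<in>UNIV. coeff1 \<phi> j (marginal l f) (k $ l)))\<^sup>2)"
  show "\<forall>k. coeff \<phi> j f k = (\<Prod>l\<in>UNIV. coeff1 \<phi> j (marginal l f) (k $ l))"
  proof
    fix k
    have "infsum ?e {k} \<le> infsum ?e UNIV"
      by (intro infsum_mono_neutral nonneg_summable_on_complete) auto
    also have "\<dots> = 0"
      using 0 by (simp add: contrast_def)
    finally show "coeff \<phi> j f k = (\<Prod>l\<in>UNIV. coeff1 \<phi> j (marginal l f) (k $ l))"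
      by (simp add: ennreal_eq_0_iff)
  qed
qed (simp add: contrast_def)

text \<open>Under factorizability the integrand is a product of functions of one coordinate each.
  Boundedness of \<phi> makes every factor integrable, as Fubini's theorem requires.\<close>

lemma coeff_factorizable:
  fixes f :: "real ^ 'd \<Rightarrow> real"
  assumes f: "integrable lborel f" "factorizable f"
    and [measurable]: "\<phi> \<in> borel_measurable borel"
    and C: "AE x in lborel. \<bar>\<phi> x\<bar> \<le> C"
  shows "coeff \<phi> j f k = (\<Prod>l\<in>UNIV. coeff1 \<phi> j (marginal l f) (k $ l))"
proof -
  have [measurable]: "f \<in> borel_measurable borel" "\<And>l. marginal l f \<in> borel_measurable borel"
    using borel_measurable_integrable[OF f(1)]
      borel_measurable_integrable[OF integrable_marginal[OF f(1)]] by simp_all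
  have "coeff \<phi> j f k = (LINT x|lborel. (\<Prod>l\<in>UNIV. marginal l f (x $ l) * dilate \<phi> j (k $ l) (x $ l)))"
    unfolding coeff_def tensor_dilate_eq_prod
  proof (rule integral_cong_AE)
    show "AE x in lborel. f x * (\<Prod>l\<in>UNIV. dilate \<phi> j (k $ l) (x $ l)) =
        (\<Prod>l\<in>UNIV. marginal l f (x $ l) * dilate \<phi> j (k $ l) (x $ l))"
      using f(2) unfolding factorizable_def
      by eventually_elim (simp add: prod.distrib)
  qed measurable
  also have "\<dots> = (\<Prod>l\<in>UNIV. coeff1 \<phi> j (marginal l f) (k $ l))"
    unfolding coeff1_def
    by (rule lborel_vec_integral_prod)
       (rule integrable_mult_dilate[OF integrable_marginal[OF f(1)] _ C], measurable)
  finally show ?thesis .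
qed

theorem proposition3p1:
  fixes f :: "real ^ 'd \<Rightarrow> real" and \<phi> :: "real \<Rightarrow> real" and C :: real and j :: int
  assumes "CARD('d) \<ge> 2"
    and "prob_density f"
    and "mra_scaling_function \<phi>"
    and "AE x in lborel. (\<lambda>k::int. \<bar>\<phi> (x + of_int k)\<bar>) summable_on UNIV \<and>
           (\<Sum>\<^sub>\<infinity>k::int. \<bar>\<phi> (x + of_int k)\<bar>) \<le> C"
  shows "(factorizable f \<longrightarrow> contrast \<phi> j f = 0) \<and>
    ((compactly_supported f \<and> compactly_supported \<phi>) \<or> square_integrable f \<longrightarrow>
      contrast \<phi> j f = 0 \<longrightarrow>
      (AE x in lborel. proj \<phi> j f x = (\<Prod>l\<in>UNIV. proj1 \<phi> j (marginal l f) (x $ l))))"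
proof -
  have f: "integrable lborel f"
    using assms(2) by (simp add: prob_density_def)
  have \<phi> [measurable]: "\<phi> \<in> borel_measurable borel"
    using assms(3) by (simp add: mra_scaling_function_def square_integrable_def)
  \<comment> \<open>The term k = 0 alone is at most the whole sum of absolute values.\<close>
  have C: "AE x in lborel. \<bar>\<phi> x\<bar> \<le> C"
    using assms(4)
  proof eventually_elim
    case (elim x)
    have "(\<Sum>\<^sub>\<infinity>k\<in>{0::int}. \<bar>\<phi> (x + of_int k)\<bar>) \<le> (\<Sum>\<^sub>\<infinity>k::int. \<bar>\<phi> (x + of_int k)\<bar>)"
      by (rule infsum_mono_neutral) (use elim in auto)
    then show ?case
      using elim by simp
  qed
  \<comment> \<open>There are finitely many coordinates, so one null set of vectors serves them
    all.\<close>
  have summ: "AE x in (lborel :: (real ^ 'd) measure).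
      \<forall>l. (\<lambda>k. \<bar>dilate \<phi> j k (x $ l)\<bar>) summable_on UNIV"
    by (subst AE_all_countable, intro allI AE_lborel_vec_nth AE_dilate_abs_summable)
       (use assms(4) in eventually_elim, simp)
  have "AE x in lborel. proj \<phi> j f x = (\<Prod>l\<in>UNIV. proj1 \<phi> j (marginal l f) (x $ l))"
    if "contrast \<phi> j f = 0"
    using summ
  proof eventually_elim
    case (elim x)
    let ?F = "\<lambda>l m. coeff1 \<phi> j (marginal l f) m * dilate \<phi> j m (x $ l)"
    have "(\<lambda>m. \<bar>?F l m\<bar>) summable_on UNIV" for l
    proof (rule summable_on_comparison_test)
      \<comment> \<open>\<open>?B\<close> depends on \<open>l\<close> but not on \<open>m\<close>,
        so the dominating series is a constant multiple of a summable one.\<close>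
      let ?B = "2 powr (of_int j / 2) * C * (LINT t|lborel. \<bar>marginal l f t\<bar>)"
      show "(\<lambda>m. ?B * \<bar>dilate \<phi> j m (x $ l)\<bar>) summable_on UNIV"
        using elim[rule_format, of l] by (rule summable_on_cmult_right)
      show "\<bar>?F l m\<bar> \<le> ?B * \<bar>dilate \<phi> j m (x $ l)\<bar>" for m
        using coeff1_bounded[OF integrable_marginal[OF f] \<phi> C, of j l m]
        unfolding abs_mult by (rule mult_right_mono) simp
    qed simp
    \<comment> \<open>The vanishing contrast factors the coefficients, and \<Phi> factors as well,
      so the summand at \<open>k\<close> is the product over \<open>l\<close> of
      \<open>?F l (k $ l)\<close>.\<close>
    then show ?case
      using infsum_prod_vec[of ?F] that
      by (simp add: proj_def proj1_def contrast_eq_0_iff tensor_dilate_eq_prod prod.distrib)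
  qed
  moreover have "contrast \<phi> j f = 0" if "factorizable f"
    unfolding contrast_eq_0_iff by (intro allI coeff_factorizable[OF f that \<phi> C])
  ultimately show ?thesis
    by blast
qed

end
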